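(* Let $K$ be a pointed homogeneous cone of rank $n$. Then the degree $d$ of minimal polynomials of $K$ satisfies $d\leq 2^{n-1}$.
   Context: Cones are closed convex cones in finite-dimensional real Euclidean spaces; $K$ is pointed if $K\cap -K=\{0\}$. A closed convex cone $K$ is homogeneous if its group of linear automorphisms acts transitively on its relative interior. The (nonzero) cone $K$ is regarded as a full-dimensional cone in its linear span, and minimal polynomials are polynomials on this span. Homogeneous cones are semialgebraic (indeed hyperbolicity cones). A minimal polynomial of a closed semialgebraic convex cone $K\subsetneq\mathcal{V}$ with nonempty interior in $\mathcal{V}$ is a nonzero polynomial on $\mathcal{V}$ of minimal degree vanishing on the boundary of $K$ (unique up to scaling, and dividing every polynomial vanishing on the boundary). Rank of a homogeneous cone (Vinberg). A T-algebra of rank $r$ is a finite-dimensional real, not necessarily associative, algebra $\mathcal{M}$ with a bigradation $\mathcal{M}=\bigoplus_{1\le i,j\le r}\mathcal{M}_{ij}$ such that $\mathcal{M}_{ij}\mathcal{M}_{jl}\subseteq\mathcal{M}_{il}$ and $\mathcal{M}_{ij}\mathcal{M}_{kl}=0$ for $j\ne k$, and with a linear involution $*$ satisfying $a^{**}=a$, $(ab)^*=b^*a^*$, $\mathcal{M}_{ij}^*=\mathcal{M}_{ji}$, such that, writing $a_{ij}$ for the $\mathcal{M}_{ij}$-component of $a$ and $\mathcal{T}=\bigoplus_{i\le j}\mathcal{M}_{ij}$ for the upper triangular elements: (1) each $\mathcal{M}_{ii}$ is a subalgebra isomorphic to $\mathbb{R}$, via an isomorphism $\rho_i$, with unit $e_i$;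 (2) $e_i a_{ij}=a_{ij}=a_{ij}e_j$ for all $a_{ij}\in\mathcal{M}_{ij}$; and, with $\operatorname{tr} a=\sum_i\rho_i(a_{ii})$, (3) $\operatorname{tr}(ab)=\operatorname{tr}(ba)$; (4) $\operatorname{tr}(a(bc))=\operatorname{tr}((ab)c)$; (5) $\operatorname{tr}(aa^* )>0$ for $a\neq0$; (6) $t(uw)=(tu)w$ for $t,u,w\in\mathcal{T}$; (7) $t(uu^* )=(tu)u^*$ for $t,u\in\mathcal{T}$. Every pointed full-dimensional homogeneous closed convex cone $K$ is the image, under a linear isomorphism from $\{a\in\mathcal{M}\mid a=a^*\}$ onto its ambient space, of $\{tt^*\mid t\in\mathcal{T}\}$ for some T-algebra $\mathcal{M}$; the rank $r$ of $\mathcal{M}$ depends only on $K$ and is called the rank of $K$. *)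

theory Defs
  imports "HOL-Analysis.Analysis"
begin

definition pointed_cone :: "'a::real_vector set \<Rightarrow> bool" where
  "pointed_cone K \<longleftrightarrow> K \<inter> uminus ` K = {0}"

text \<open>The automorphisms of \<open>K\<close> are the linear bijections of its span mapping \<open>K\<close> onto
  itself. They are represented by endomorphisms of the ambient space, of which only the restriction
  to the span is relevant; every linear map on the span has such an extension.\<close>

definition cone_automorphism :: "'a::real_vector set \<Rightarrow> ('a \<Rightarrow> 'a) \<Rightarrow> bool" where
  "cone_automorphism K f \<longleftrightarrow> linear f \<and> bij_betw f (span K) (span K) \<and> f ` K = K"

definition homogeneous_cone :: "'a::euclidean_space set \<Rightarrow> bool" where
  "homogeneous_cone K \<longleftrightarrow> closed K \<and> convex K \<and> cone K \<and> K \<noteq> {} \<and>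
     (\<forall>x\<in>rel_interior K. \<forall>y\<in>rel_interior K. \<exists>f. cone_automorphism K f \<and> f x = y)"


text \<open>A polynomial on a subspace \<open>V\<close> is represented by a function on the ambient space of which
  only the restriction to \<open>V\<close> is relevant. Composing with a linear projection onto \<open>V\<close> shows
  that the polynomials of degree at most \<open>d\<close> on \<open>V\<close> are exactly the restrictions of those on
  the ambient space, which are written in the coordinates of the standard basis.\<close>

definition polynomial_on_deg_le :: "'a::euclidean_space set \<Rightarrow> nat \<Rightarrow> ('a \<Rightarrow> real) \<Rightarrow> bool" where
  "polynomial_on_deg_le V d p \<longleftrightarrow>
     (\<exists>c. \<forall>x\<in>V. p x =
        (\<Sum>\<alpha> \<in> {\<alpha> \<in> Basis \<rightarrow>\<^sub>E (UNIV :: nat set). (\<Sum>b\<in>Basis. \<alpha> b) \<le> d}.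
           c \<alpha> * (\<Prod>b\<in>Basis. (x \<bullet> b) ^ \<alpha> b)))"

definition polynomial_on :: "'a::euclidean_space set \<Rightarrow> ('a \<Rightarrow> real) \<Rightarrow> bool" where
  "polynomial_on V p \<longleftrightarrow> (\<exists>d. polynomial_on_deg_le V d p)"

definition degree_on :: "'a::euclidean_space set \<Rightarrow> ('a \<Rightarrow> real) \<Rightarrow> nat" where
  "degree_on V p = (LEAST d. polynomial_on_deg_le V d p)"

text \<open>The boundary of \<open>K\<close> in its span is its relative frontier: a nonempty closed cone contains
  the origin, so its affine hull is its span.\<close>

definition boundary_polynomial :: "'a::euclidean_space set \<Rightarrow> ('a \<Rightarrow> real) \<Rightarrow> bool" where
  "boundary_polynomial K p \<longleftrightarrow>
     polynomial_on (span K) p \<and> (\<exists>x\<in>span K. p x \<noteq> 0) \<and> (\<forall>x\<in>rel_frontier K. p x = 0)"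

definition minimal_polynomial :: "'a::euclidean_space set \<Rightarrow> ('a \<Rightarrow> real) \<Rightarrow> bool" where
  "minimal_polynomial K p \<longleftrightarrow> boundary_polynomial K p \<and>
     (\<forall>q. boundary_polynomial K q \<longrightarrow> degree_on (span K) p \<le> degree_on (span K) q)"


text \<open>The algebra is the whole type \<open>'m\<close>; its bigradation is indexed by \<open>{1..r}\<close>, and the
  values of \<open>M\<close> at other indices are irrelevant.\<close>

locale bigraded_algebra =
  fixes r :: nat
    and M :: "nat \<Rightarrow> nat \<Rightarrow> 'm::real_vector set"
    and mult :: "'m \<Rightarrow> 'm \<Rightarrow> 'm" (infixl "\<cdot>" 70)
  assumes finite_dimensional: "\<exists>B::'m set. finite B \<and> span B = UNIV"
    and bilinear_mult: "bilinear (\<cdot>)"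
    and subspace_M: "\<lbrakk>i \<in> {1..r}; j \<in> {1..r}\<rbrakk> \<Longrightarrow> subspace (M i j)"
    and direct_sum_M:
      "\<exists>!f. f \<in> (\<Pi>\<^sub>E (i, j) \<in> {1..r} \<times> {1..r}. M i j) \<and> a = (\<Sum>ij \<in> {1..r} \<times> {1..r}. f ij)"
    and mult_M: "\<lbrakk>i \<in> {1..r}; j \<in> {1..r}; l \<in> {1..r}; a \<in> M i j; b \<in> M j l\<rbrakk> \<Longrightarrow> a \<cdot> b \<in> M i l"
    and mult_M_zero: "\<lbrakk>i \<in> {1..r}; j \<in> {1..r}; k \<in> {1..r}; l \<in> {1..r}; j \<noteq> k; a \<in> M i j; b \<in> M k l\<rbrakk>
      \<Longrightarrow> a \<cdot> b = 0"
begin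

definition component :: "nat \<Rightarrow> nat \<Rightarrow> 'm \<Rightarrow> 'm" where
  "component i j a =
     (THE f. f \<in> (\<Pi>\<^sub>E (i, j) \<in> {1..r} \<times> {1..r}. M i j) \<and> a = (\<Sum>ij \<in> {1..r} \<times> {1..r}. f ij)) (i, j)"

definition upper_triangular :: "'m set" where
  "upper_triangular = span (\<Union>i\<in>{1..r}. \<Union>j\<in>{i..r}. M i j)"

definition trace :: "(nat \<Rightarrow> 'm \<Rightarrow> real) \<Rightarrow> 'm \<Rightarrow> real" where
  "trace \<rho> a = (\<Sum>i = 1..r. \<rho> i (component i i a))"

end

text \<open>Only the restriction of \<open>\<rho> i\<close> to \<open>M i i\<close> is relevant: it is the isomorphism onto the
  reals, and every linear form on \<open>M i i\<close> extends to the whole algebra. Both \<open>\<rho> i\<close> on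
  \<open>M i i\<close> and the unit \<open>e i\<close> are uniquely determined by the algebra.\<close>

locale T_algebra = bigraded_algebra r M mult
  for r :: nat
    and M :: "nat \<Rightarrow> nat \<Rightarrow> 'm::real_vector set"
    and mult :: "'m \<Rightarrow> 'm \<Rightarrow> 'm" (infixl "\<cdot>" 70) +
  fixes star :: "'m \<Rightarrow> 'm"
    and \<rho> :: "nat \<Rightarrow> 'm \<Rightarrow> real"
    and e :: "nat \<Rightarrow> 'm"
  assumes linear_star: "linear star"
    and star_star: "star (star a) = a"
    and star_mult: "star (a \<cdot> b) = star b \<cdot> star a"
    and star_M: "\<lbrakk>i \<in> {1..r}; j \<in> {1..r}\<rbrakk> \<Longrightarrow> star ` M i j = M j i"
    and linear_rho: "i \<in> {1..r} \<Longrightarrow> linear (\<rho> i)"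
    and bij_rho: "i \<in> {1..r} \<Longrightarrow> bij_betw (\<rho> i) (M i i) UNIV"
    and rho_mult: "\<lbrakk>i \<in> {1..r}; a \<in> M i i; b \<in> M i i\<rbrakk> \<Longrightarrow> \<rho> i (a \<cdot> b) = \<rho> i a * \<rho> i b"
    and unit_M: "i \<in> {1..r} \<Longrightarrow> e i \<in> M i i"
    and rho_unit: "i \<in> {1..r} \<Longrightarrow> \<rho> i (e i) = 1"
    and unit_left: "\<lbrakk>i \<in> {1..r}; j \<in> {1..r}; a \<in> M i j\<rbrakk> \<Longrightarrow> e i \<cdot> a = a"
    and unit_right: "\<lbrakk>i \<in> {1..r}; j \<in> {1..r}; a \<in> M i j\<rbrakk> \<Longrightarrow> a \<cdot> e j = a"
    and trace_commute: "trace \<rho> (a \<cdot> b) = trace \<rho> (b \<cdot> a)"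
    and trace_assoc: "trace \<rho> (a \<cdot> (b \<cdot> c)) = trace \<rho> ((a \<cdot> b) \<cdot> c)"
    and trace_star_pos: "a \<noteq> 0 \<Longrightarrow> trace \<rho> (a \<cdot> star a) > 0"
    and upper_assoc:
      "\<lbrakk>t \<in> upper_triangular; u \<in> upper_triangular; w \<in> upper_triangular\<rbrakk>
        \<Longrightarrow> t \<cdot> (u \<cdot> w) = (t \<cdot> u) \<cdot> w"
    and upper_star_assoc:
      "\<lbrakk>t \<in> upper_triangular; u \<in> upper_triangular\<rbrakk> \<Longrightarrow> t \<cdot> (u \<cdot> star u) = (t \<cdot> u) \<cdot> star u"
begin

definition hermitian :: "'m set" where
  "hermitian = {a. star a = a}"

definition associated_cone :: "'m set" where
  "associated_cone = {t \<cdot> star t | t. t \<in> upper_triangular}"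

end

text \<open>\<open>has_rank TYPE('m) K r\<close>: the cone \<open>K\<close> is realised, inside its span, by a T-algebra of
  rank \<open>r\<close> carried by the type \<open>'m\<close>. The type argument is needed because the underlying vector
  space of the algebra cannot be existentially quantified.\<close>

definition has_rank :: "'m::real_vector itself \<Rightarrow> 'a::real_vector set \<Rightarrow> nat \<Rightarrow> bool" where
  "has_rank T K r \<longleftrightarrow>
     (\<exists>M (mult :: 'm \<Rightarrow> 'm \<Rightarrow> 'm) star \<rho> e \<phi>.
        T_algebra r M mult star \<rho> e \<and> linear \<phi> \<and>
        bij_betw \<phi> (T_algebra.hermitian star) (span K) \<and>
        K = \<phi> ` T_algebra.associated_cone r M mult star)"

end

theory Submission
  imports Defs
begin

text \<open>In a T-algebra of rank \<open>n\<close>, Gaussian elimination from the last index downwards replaces a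
  hermitian element \<open>a\<close> by \<open>a\<^sub>k\<^sub>k a - c c*\<close>, where \<open>c = a e\<^sub>k\<close> is its \<open>k\<close>-th column. Not dividing by the
  pivot keeps this polynomial and doubles the degree, so that the last pivot is a polynomial of
  degree at most \<open>2\<^sup>n\<^sup>-\<^sup>1\<close>. At \<open>a = t t*\<close> with \<open>t\<close> upper triangular, every pivot is a product of
  squares of diagonal entries of \<open>t\<close>, and the last one involves them all. If it does not vanish, all
  pivots are positive. This is an open condition, and it allows the elimination to be reversed into a
  Cholesky factorisation, so \<open>a\<close> lies in the interior of the cone. Hence the last pivot vanishes on
  the boundary.\<close>

section \<open>Polynomials on Euclidean spaces\<close>

definition exponents :: "nat \<Rightarrow> ('a::euclidean_space \<Rightarrow> nat) set" where
  "exponents d = {\<alpha> \<in> Basis \<rightarrow>\<^sub>E (UNIV :: nat set). (\<Sum>b\<in>Basis. \<alpha> b) \<le> d}"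

definition monomial :: "('a::euclidean_space \<Rightarrow> nat) \<Rightarrow> 'a \<Rightarrow> real" where
  "monomial \<alpha> x = (\<Prod>b\<in>Basis. (x \<bullet> b) ^ \<alpha> b)"

lemma polynomial_on_deg_le_iff:
  "polynomial_on_deg_le V d p \<longleftrightarrow>
     (\<exists>c. \<forall>x\<in>V. p x = (\<Sum>\<alpha>\<in>exponents d. c \<alpha> * monomial \<alpha> x))"
  by (simp add: polynomial_on_deg_le_def exponents_def monomial_def)

lemma finite_exponents: "finite (exponents d :: ('a::euclidean_space \<Rightarrow> nat) set)"
proof (rule finite_subset)
  show "exponents d \<subseteq> (Basis :: 'a set) \<rightarrow>\<^sub>E {..d}"
  proof
    fix \<alpha> :: "'a \<Rightarrow> nat" assume a: "\<alpha> \<in> exponents d"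
    have "\<alpha> b \<le> d" if "b \<in> Basis" for b
      using member_le_sum[of b Basis \<alpha>] that a by (force simp: exponents_def)
    then show "\<alpha> \<in> Basis \<rightarrow>\<^sub>E {..d}"
      using a by (auto simp: exponents_def PiE_iff)
  qed
  show "finite ((Basis :: 'a set) \<rightarrow>\<^sub>E {..d})"
    by (intro finite_PiE) auto
qed

lemma polynomial_on_deg_le_subset:
  "\<lbrakk>polynomial_on_deg_le W d p; V \<subseteq> W\<rbrakk> \<Longrightarrow> polynomial_on_deg_le V d p"
  unfolding polynomial_on_deg_le_def by blast

lemma polynomial_on_deg_le_monomial:
  assumes "\<alpha> \<in> exponents d"
  shows "polynomial_on_deg_le V d (monomial \<alpha>)"
  unfolding polynomial_on_deg_le_iff
proof (intro exI ballI)
  fix x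
  show "monomial \<alpha> x = (\<Sum>\<beta>\<in>exponents d. (if \<beta> = \<alpha> then 1 else 0) * monomial \<beta> x)"
    using assms by (simp add: if_distrib[of "\<lambda>u. u * _"] finite_exponents cong: if_cong)
qed

lemma polynomial_on_deg_le_0: "polynomial_on_deg_le V d (\<lambda>x. 0)"
  unfolding polynomial_on_deg_le_def by (rule exI[of _ "\<lambda>_. 0"]) simp

lemma polynomial_on_deg_le_add:
  assumes "polynomial_on_deg_le V d p" "polynomial_on_deg_le V d q"
  shows "polynomial_on_deg_le V d (\<lambda>x. p x + q x)"
proof -
  obtain a b where "\<forall>x\<in>V. p x = (\<Sum>\<alpha>\<in>exponents d. a \<alpha> * monomial \<alpha> x)"
    "\<forall>x\<in>V. q x = (\<Sum>\<alpha>\<in>exponents d. b \<alpha> * monomial \<alpha> x)"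
    using assms unfolding polynomial_on_deg_le_iff by blast
  then have "\<forall>x\<in>V. p x + q x = (\<Sum>\<alpha>\<in>exponents d. (a \<alpha> + b \<alpha>) * monomial \<alpha> x)"
    by (simp add: sum.distrib distrib_right)
  then show ?thesis
    unfolding polynomial_on_deg_le_iff by (rule exI[where x = "\<lambda>\<alpha>. a \<alpha> + b \<alpha>"])
qed

lemma polynomial_on_deg_le_cmult:
  assumes "polynomial_on_deg_le V d p"
  shows "polynomial_on_deg_le V d (\<lambda>x. k * p x)"
proof -
  obtain a where "\<forall>x\<in>V. p x = (\<Sum>\<alpha>\<in>exponents d. a \<alpha> * monomial \<alpha> x)"
    using assms unfolding polynomial_on_deg_le_iff by blast
  then have "\<forall>x\<in>V. k * p x = (\<Sum>\<alpha>\<in>exponents d. (k * a \<alpha>) * monomial \<alpha> x)"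
    by (simp add: sum_distrib_left mult.assoc)
  then show ?thesis
    unfolding polynomial_on_deg_le_iff by (rule exI[where x = "\<lambda>\<alpha>. k * a \<alpha>"])
qed

lemma polynomial_on_deg_le_sum:
  assumes "\<And>i. i \<in> I \<Longrightarrow> polynomial_on_deg_le V d (p i)"
  shows "polynomial_on_deg_le V d (\<lambda>x. \<Sum>i\<in>I. p i x)"
  using assms
  by (induction I rule: infinite_finite_induct)
    (auto intro: polynomial_on_deg_le_0 polynomial_on_deg_le_add)

lemma polynomial_on_deg_le_cong:
  "\<lbrakk>polynomial_on_deg_le V d p; \<And>x. x \<in> V \<Longrightarrow> q x = p x\<rbrakk> \<Longrightarrow> polynomial_on_deg_le V d q"
  unfolding polynomial_on_deg_le_def by auto

text \<open>The \<open>restrict\<close> makes the sum of two exponents \<open>undefined\<close>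
  outside \<open>Basis\<close> again, so that it can belong to \<open>exponents\<close> of the added
  degrees.\<close>

lemma monomial_mult:
  "monomial \<alpha> x * monomial \<beta> x = monomial (restrict (\<lambda>b. \<alpha> b + \<beta> b) Basis) x"
  by (simp add: monomial_def power_add prod.distrib)

lemma polynomial_on_deg_le_mult:
  assumes "polynomial_on_deg_le V d p" "polynomial_on_deg_le V d' q"
  shows "polynomial_on_deg_le V (d + d') (\<lambda>x. p x * q x)"
proof -
  obtain a b where *: "\<forall>x\<in>V. p x = (\<Sum>\<alpha>\<in>exponents d. a \<alpha> * monomial \<alpha> x)"
    "\<forall>x\<in>V. q x = (\<Sum>\<beta>\<in>exponents d'. b \<beta> * monomial \<beta> x)"
    using assms unfolding polynomial_on_deg_le_iff by blast
  let ?m = "\<lambda>\<alpha> \<beta>. restrict (\<lambda>b::'a. \<alpha> b + \<beta> b) Basis"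
  have "polynomial_on_deg_le V (d + d')
    (\<lambda>x. \<Sum>\<alpha>\<in>exponents d. \<Sum>\<beta>\<in>exponents d'. (a \<alpha> * b \<beta>) * monomial (?m \<alpha> \<beta>) x)"
    by (intro polynomial_on_deg_le_sum polynomial_on_deg_le_cmult polynomial_on_deg_le_monomial)
      (auto simp: exponents_def sum.distrib intro: add_mono)
  then show ?thesis
    by (rule polynomial_on_deg_le_cong)
      (simp add: * sum_product monomial_mult[symmetric] ac_simps)
qed

lemma polynomial_on_deg_le_inner:
  assumes "b \<in> Basis"
  shows "polynomial_on_deg_le V 1 (\<lambda>x. x \<bullet> b)"
proof -
  let ?\<alpha> = "restrict (\<lambda>b'. if b' = b then 1 else 0) Basis"
  have "polynomial_on_deg_le V 1 (monomial ?\<alpha>)"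
    using assms by (intro polynomial_on_deg_le_monomial) (auto simp: exponents_def)
  moreover have "monomial ?\<alpha> = (\<lambda>x. x \<bullet> b)"
    using assms by (simp add: fun_eq_iff monomial_def if_distrib[of "\<lambda>u. _ ^ u"] cong: if_cong)
  ultimately show ?thesis
    by simp
qed

lemma polynomial_on_deg_le_continuous:
  assumes "polynomial_on_deg_le V d p"
  shows "continuous_on V p"
proof -
  obtain a where "\<forall>x\<in>V. p x = (\<Sum>\<alpha>\<in>exponents d. a \<alpha> * monomial \<alpha> x)"
    using assms unfolding polynomial_on_deg_le_iff by blast
  moreover have "continuous_on V (\<lambda>x. \<Sum>\<alpha>\<in>exponents d. a \<alpha> * monomial \<alpha> x)"
    unfolding monomial_def by (intro continuous_intros)
  ultimately show ?thesis
    by (simp cong: continuous_on_cong)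
qed

section \<open>Polynomial maps into a vector space\<close>

text \<open>The target is a bare real vector space, with neither topology nor chosen basis, so its
  points are written as combinations of fixed vectors \<open>m i\<close> with polynomial
  coefficients. The indices are natural numbers because a definition cannot quantify over an index
  type; \<open>polynomial_mapI\<close> admits every finite index set.\<close>

definition polynomial_map :: "nat \<Rightarrow> ('a::euclidean_space \<Rightarrow> 'm::real_vector) \<Rightarrow> bool" where
  "polynomial_map d f \<longleftrightarrow> (\<exists>(I::nat set) q m. finite I \<and>
     (\<forall>i\<in>I. polynomial_on_deg_le UNIV d (q i)) \<and> f = (\<lambda>x. \<Sum>i\<in>I. q i x *\<^sub>R m i))"

lemma polynomial_mapI:
  assumes "finite I" "\<And>i. i \<in> I \<Longrightarrow> polynomial_on_deg_le UNIV d (q i)"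
    "\<And>x. f x = (\<Sum>i\<in>I. q i x *\<^sub>R m i)"
  shows "polynomial_map d f"
proof -
  obtain g where g: "bij_betw g {..<card I} I"
    using assms(1) by (metis atLeast0LessThan ex_bij_betw_nat_finite)
  show ?thesis unfolding polynomial_map_def
  proof (intro exI[of _ "{..<card I}"] exI[of _ "\<lambda>i. q (g i)"] exI[of _ "\<lambda>i. m (g i)"] conjI ballI)
    show "polynomial_on_deg_le UNIV d (q (g i))" if "i \<in> {..<card I}" for i
      using assms(2) g that by (meson bij_betwE)
    show "f = (\<lambda>x. \<Sum>i<card I. q (g i) x *\<^sub>R m (g i))"
      using sum.reindex_bij_betw[OF g, of "\<lambda>i. q i _ *\<^sub>R m i"] by (simp add: assms(3) fun_eq_iff)
  qed simp
qed

lemma polynomial_map_linear: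
  assumes "linear f"
  shows "polynomial_map 1 f"
proof (rule polynomial_mapI)
  show "f x = (\<Sum>b\<in>Basis. (x \<bullet> b) *\<^sub>R f b)" for x
    using linear_sum[OF assms, of "\<lambda>b. (x \<bullet> b) *\<^sub>R b" Basis]
    by (simp add: euclidean_representation linear_scale[OF assms])
qed (auto intro: polynomial_on_deg_le_inner[unfolded One_nat_def])

lemma polynomial_map_linear_compose:
  assumes "polynomial_map d f" "linear l"
  shows "polynomial_map d (\<lambda>x. l (f x))"
proof -
  obtain I :: "nat set" and q m where *: "finite I"
      "\<forall>i\<in>I. polynomial_on_deg_le UNIV d (q i)" "f = (\<lambda>x. \<Sum>i\<in>I. q i x *\<^sub>R m i)"
    using assms(1) unfolding polynomial_map_def by blast
  show ?thesis
    by (rule polynomial_mapI[of I d q _ "\<lambda>i. l (m i)"])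
      (use * in \<open>auto simp: linear_sum[OF assms(2)] linear_scale[OF assms(2)]\<close>)
qed

lemma polynomial_map_real:
  fixes f :: "'a::euclidean_space \<Rightarrow> real"
  assumes "polynomial_map d f"
  shows "polynomial_on_deg_le UNIV d f"
proof -
  obtain I :: "nat set" and q m where *: "finite I"
      "\<forall>i\<in>I. polynomial_on_deg_le UNIV d (q i)" "f = (\<lambda>x. \<Sum>i\<in>I. q i x *\<^sub>R m i)"
    using assms unfolding polynomial_map_def by blast
  have "polynomial_on_deg_le UNIV d (\<lambda>x. \<Sum>i\<in>I. m i * q i x)"
    using * by (intro polynomial_on_deg_le_sum polynomial_on_deg_le_cmult) auto
  then show ?thesis
    using * by (simp add: mult.commute)
qed

text \<open>Expanding both arguments gives a sum over \<open>I \<times> J\<close> whose coefficients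
  are products of polynomials. The quadratic steps of the elimination are of this kind.\<close>

lemma polynomial_map_bilinear:
  assumes "polynomial_map d f" "polynomial_map d' g" "bilinear h"
  shows "polynomial_map (d + d') (\<lambda>x. h (f x) (g x))"
proof -
  obtain I :: "nat set" and q m where I: "finite I"
      "\<forall>i\<in>I. polynomial_on_deg_le UNIV d (q i)" "f = (\<lambda>x. \<Sum>i\<in>I. q i x *\<^sub>R m i)"
    using assms(1) unfolding polynomial_map_def by blast
  obtain J :: "nat set" and q' m' where J: "finite J"
      "\<forall>i\<in>J. polynomial_on_deg_le UNIV d' (q' i)" "g = (\<lambda>x. \<Sum>i\<in>J. q' i x *\<^sub>R m' i)"
    using assms(2) unfolding polynomial_map_def by blast
  show ?thesis
  proof (rule polynomial_mapI)
    show "h (f x) (g x) =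
        (\<Sum>ij\<in>I \<times> J. (q (fst ij) x * q' (snd ij) x) *\<^sub>R h (m (fst ij)) (m' (snd ij)))" for x
      by (simp add: I(3) J(3) bilinear_sum[OF assms(3)] bilinear_lmul[OF assms(3)]
          bilinear_rmul[OF assms(3)] case_prod_beta mult.commute)
  qed (use I J in \<open>auto intro: polynomial_on_deg_le_mult\<close>)
qed

lemma polynomial_map_add:
  assumes "polynomial_map d f" "polynomial_map d g"
  shows "polynomial_map d (\<lambda>x. f x + g x)"
proof -
  obtain I :: "nat set" and q m where I: "finite I"
      "\<forall>i\<in>I. polynomial_on_deg_le UNIV d (q i)" "f = (\<lambda>x. \<Sum>i\<in>I. q i x *\<^sub>R m i)"
    using assms(1) unfolding polynomial_map_def by blast
  obtain J :: "nat set" and q' m' where J: "finite J"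
      "\<forall>i\<in>J. polynomial_on_deg_le UNIV d (q' i)" "g = (\<lambda>x. \<Sum>i\<in>J. q' i x *\<^sub>R m' i)"
    using assms(2) unfolding polynomial_map_def by blast
  show ?thesis
    by (rule polynomial_mapI[of "I <+> J" d "case_sum q q'" _ "case_sum m m'"])
      (use I J in \<open>auto simp: sum.Plus\<close>)
qed

lemma polynomial_map_diff:
  assumes "polynomial_map d f" "polynomial_map d g"
  shows "polynomial_map d (\<lambda>x. f x - g x)"
  using polynomial_map_add[OF assms(1) polynomial_map_linear_compose[OF assms(2), of uminus]]
  by (simp add: linear_uminus)


section \<open>Cholesky factorisation in T-algebras\<close>

text \<open>Two span inductions, one in each argument, reduce to generators, where the bigrading can
  be applied. With \<open>W = {0}\<close> this shows that products vanish.\<close>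

lemma span_mult_subset:
  assumes "bilinear h" "subspace W" "\<And>a b. a \<in> X \<Longrightarrow> b \<in> Y \<Longrightarrow> h a b \<in> W"
    "a \<in> span X" "b \<in> span Y"
  shows "h a b \<in> W"
proof -
  have *: "h a b \<in> W" if "a \<in> X" "b \<in> span Y" for a b
    using that(2)
  proof (induction rule: span_induct)
    case base
    show ?case
      using assms(1,2) by (auto simp: subspace_def bilinear_rzero bilinear_radd bilinear_rmul)
  qed (use assms(3) that(1) in auto)
  show ?thesis
    using assms(4)
  proof (induction rule: span_induct)
    case base
    show ?case
      using assms(1,2) by (auto simp: subspace_def bilinear_lzero bilinear_ladd bilinear_lmul)
  qed (use * assms(5) in auto)
qed

context T_algebra
begin

lemmas mult_simps = bilinear_ladd[OF bilinear_mult] bilinear_radd[OF bilinear_mult]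
  bilinear_lsub[OF bilinear_mult] bilinear_rsub[OF bilinear_mult]
  bilinear_lmul[OF bilinear_mult] bilinear_rmul[OF bilinear_mult]
  bilinear_lzero[OF bilinear_mult] bilinear_rzero[OF bilinear_mult]

lemmas star_simps = linear_add[OF linear_star] linear_diff[OF linear_star]
  linear_scale[OF linear_star] linear_0[OF linear_star] star_star star_mult

section \<open>Blocks, columns and pivots\<close>

definition block :: "nat \<Rightarrow> 'm set" where
  "block k = span (\<Union>i\<in>{1..k}. \<Union>j\<in>{1..k}. M i j)"

definition upper_block :: "nat \<Rightarrow> 'm set" where
  "upper_block k = span (\<Union>i\<in>{1..k}. \<Union>j\<in>{i..k}. M i j)"

text \<open>The part of column \<open>Suc k\<close> strictly above the diagonal. Together with its
  adjoint and \<open>e (Suc k)\<close> it extends \<open>block k\<close> to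
  \<open>block (Suc k)\<close>.\<close>

definition column :: "nat \<Rightarrow> 'm set" where
  "column k = span (\<Union>i\<in>{1..k}. M i (Suc k))"

text \<open>Multiplication by the unit on both sides cuts out the diagonal entry at
  \<open>k\<close>. This form avoids the definite description in \<open>component\<close>, and
  linearity in \<open>a\<close> follows from that of the product.\<close>

definition pivot :: "nat \<Rightarrow> 'm \<Rightarrow> real" where
  "pivot k a = \<rho> k (e k \<cdot> (a \<cdot> e k))"

definition schur :: "nat \<Rightarrow> 'm \<Rightarrow> 'm" where
  "schur k a = pivot k a *\<^sub>R a - (a \<cdot> e k) \<cdot> star (a \<cdot> e k)"

primrec pivots_pos :: "nat \<Rightarrow> 'm \<Rightarrow> bool" where
  "pivots_pos 0 a \<longleftrightarrow> True"
| "pivots_pos (Suc k) a \<longleftrightarrow> pivot (Suc k) a > 0 \<and> pivots_pos k (schur (Suc k) a)"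

text \<open>Stopping at \<open>k = 1\<close> rather than \<open>k = 0\<close> saves one doubling of the degree. The value at \<open>k = 0\<close>
  is arbitrary.\<close>

primrec last_pivot :: "nat \<Rightarrow> 'm \<Rightarrow> real" where
  "last_pivot 0 a = 1"
| "last_pivot (Suc k) a = (if k = 0 then pivot (Suc k) a else last_pivot k (schur (Suc k) a))"

lemma subspace_block: "subspace (block k)" and subspace_upper_block: "subspace (upper_block k)"
  and subspace_column: "subspace (column k)"
  by (simp_all add: block_def upper_block_def column_def)

lemma upper_block_subset_block: "upper_block k \<subseteq> block k"
  unfolding upper_block_def block_def by (intro span_mono) fastforce

lemma upper_block_mono: "k \<le> l \<Longrightarrow> upper_block k \<subseteq> upper_block l"
  unfolding upper_block_def by (intro span_mono) fastforce

lemma block_r: "block r = UNIV"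
proof -
  have "a \<in> block r" for a
  proof -
    obtain f where f: "f \<in> (\<Pi>\<^sub>E (i, j) \<in> {1..r} \<times> {1..r}. M i j)"
      "a = (\<Sum>ij \<in> {1..r} \<times> {1..r}. f ij)"
      using direct_sum_M[of a] by blast
    have "f ij \<in> block r" if "ij \<in> {1..r} \<times> {1..r}" for ij
      using PiE_mem[OF f(1) that] that unfolding block_def by (intro span_base) auto
    then show ?thesis
      unfolding f(2) by (intro subspace_sum subspace_block) auto
  qed
  then show ?thesis by blast
qed

lemma block_base: "\<lbrakk>i \<in> {1..k}; j \<in> {1..k}; a \<in> M i j\<rbrakk> \<Longrightarrow> a \<in> block k"
  unfolding block_def by (intro span_base) blast

text \<open>The unit law gives \<open>e i \<cdot> star (e i) = star (e i)\<close>. The left side is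
  fixed by \<open>star\<close>, hence so is \<open>star (e i)\<close>.\<close>

lemma star_unit:
  assumes "i \<in> {1..r}"
  shows "star (e i) = e i"
proof -
  have "star (e i) \<in> M i i"
    using star_M[OF assms assms] unit_M[OF assms] by blast
  then have "e i \<cdot> star (e i) = star (e i)"
    using unit_left assms by blast
  then show ?thesis
    by (metis star_mult star_star)
qed

lemma star_block:
  assumes "k \<le> r" "a \<in> block k"
  shows "star a \<in> block k"
  using assms(2) unfolding block_def
proof (induction rule: span_induct)
  case base
  show ?case
    by (auto simp: subspace_def star_simps span_zero intro: span_add span_scale)
next
  case (step a)
  then obtain i j where "i \<in> {1..k}" "j \<in> {1..k}" "a \<in> M i j" by blast
  then have "star a \<in> M j i" using star_M[of i j] assms(1) by auto
  then show ?case using \<open>i \<in> {1..k}\<close> \<open>j \<in> {1..k}\<close> by (intro span_base) blast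
qed

text \<open>Both sides lie in \<open>M i i\<close> and have the same image under
  \<open>\<rho> i\<close>, which is injective there.\<close>

lemma diagonal_eq:
  assumes "i \<in> {1..r}" "a \<in> M i i"
  shows "a = \<rho> i a *\<^sub>R e i"
proof -
  have "\<rho> i (\<rho> i a *\<^sub>R e i) = \<rho> i a"
    by (simp add: linear_scale[OF linear_rho[OF assms(1)]] rho_unit[OF assms(1)])
  moreover have "\<rho> i a *\<^sub>R e i \<in> M i i"
    using subspace_M unit_M assms(1) by (auto intro: subspace_scale)
  ultimately show ?thesis
    using bij_rho[OF assms(1)] assms(2) by (metis bij_betw_imp_inj_on inj_onD)
qed

section \<open>Passing from order k to order k + 1\<close>

context
  fixes k assumes k: "Suc k \<le> r"
begin

lemma unit_unit: "e (Suc k) \<cdot> e (Suc k) = e (Suc k)"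
  using k unit_M[of "Suc k"] unit_left[of "Suc k" "Suc k"] by simp

text \<open>The indices in \<open>block k\<close> stop before \<open>Suc k\<close>, so the inner
  indices of the product never match. The second product is the adjoint of the first one, taken at
  \<open>star a\<close>.\<close>

lemma block_unit:
  assumes "a \<in> block k"
  shows "a \<cdot> e (Suc k) = 0" "e (Suc k) \<cdot> a = 0"
proof -
  have *: "a \<cdot> e (Suc k) = 0" if "a \<in> block k" for a
  proof -
    have "a \<cdot> e (Suc k) \<in> {0}"
    proof (rule span_mult_subset[OF bilinear_mult _ _ that[unfolded block_def]])
      show "e (Suc k) \<in> span {e (Suc k)}" by (simp add: span_base)
      fix a b assume "a \<in> (\<Union>i\<in>{1..k}. \<Union>j\<in>{1..k}. M i j)" "b \<in> {e (Suc k)}"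
      then obtain i j where "i \<in> {1..k}" "j \<in> {1..k}" "a \<in> M i j" "b = e (Suc k)"
        by blast
      then show "a \<cdot> b \<in> {0}"
        using k unit_M[of "Suc k"] mult_M_zero[of i j "Suc k" "Suc k" a b] by simp
    qed simp
    then show ?thesis by simp
  qed
  then show "a \<cdot> e (Suc k) = 0" using assms .
  have "star (star a \<cdot> e (Suc k)) = 0"
    using * star_block[OF _ assms] k by (simp add: star_simps)
  then show "e (Suc k) \<cdot> a = 0"
    using k star_unit[of "Suc k"] by (simp add: star_simps)
qed

lemma column_unit:
  assumes "v \<in> column k"
  shows "v \<cdot> e (Suc k) = v" "e (Suc k) \<cdot> v = 0"
    "e (Suc k) \<cdot> star v = star v" "star v \<cdot> e (Suc k) = 0"
proof -
  show 1: "v \<cdot> e (Suc k) = v"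
    using assms unfolding column_def
  proof (induction rule: span_induct)
    case base
    show ?case by (auto simp: subspace_def mult_simps)
  next
    case (step x)
    then obtain i where "i \<in> {1..k}" "x \<in> M i (Suc k)" by blast
    then show ?case using k unit_right[of i "Suc k" x] by simp
  qed
  show 2: "e (Suc k) \<cdot> v = 0"
    using assms unfolding column_def
  proof (induction rule: span_induct)
    case base
    show ?case by (auto simp: subspace_def mult_simps)
  next
    case (step x)
    then obtain i where "i \<in> {1..k}" "x \<in> M i (Suc k)" by blast
    then show ?case
      using k unit_M[of "Suc k"] mult_M_zero[of "Suc k" "Suc k" i "Suc k" "e (Suc k)" x] by simp
  qed
  show "e (Suc k) \<cdot> star v = star v" "star v \<cdot> e (Suc k) = 0"
    using arg_cong[OF 1, of star] arg_cong[OF 2, of star] k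
    by (simp_all add: star_simps star_unit)
qed

lemma column_star_column:
  assumes "v \<in> column k" "w \<in> column k"
  shows "v \<cdot> star w \<in> block k"
proof -
  \<comment> \<open>The adjoint is absorbed into the bilinear map, so that both arguments range over
    the span defining \<open>column k\<close>.\<close>
  have "bilinear (\<lambda>v w. v \<cdot> star w)"
    by (auto simp: bilinear_def linear_iff mult_simps star_simps)
  then show ?thesis
  proof (rule span_mult_subset[OF _ subspace_block _ assms[unfolded column_def]])
    fix a b assume "a \<in> (\<Union>i\<in>{1..k}. M i (Suc k))" "b \<in> (\<Union>i\<in>{1..k}. M i (Suc k))"
    then obtain i j where "i \<in> {1..k}" "a \<in> M i (Suc k)" "j \<in> {1..k}" "b \<in> M j (Suc k)"
      by blast
    moreover from this have "star b \<in> M (Suc k) j"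
      using star_M[of j "Suc k"] k by auto
    ultimately show "a \<cdot> star b \<in> block k"
      using mult_M[of i "Suc k" j a "star b"] k by (auto intro: block_base)
  qed
qed

lemma block_star_column:
  assumes "a \<in> block k" "v \<in> column k"
  shows "a \<cdot> star v = 0" "v \<cdot> star a = 0"
proof -
  have "bilinear (\<lambda>v w. v \<cdot> star w)"
    by (auto simp: bilinear_def linear_iff mult_simps star_simps)
  then have "a \<cdot> star v \<in> {0}"
  proof (rule span_mult_subset[OF _ _ _ assms[unfolded column_def block_def]])
    fix a b assume "a \<in> (\<Union>i\<in>{1..k}. \<Union>j\<in>{1..k}. M i j)" "b \<in> (\<Union>i\<in>{1..k}. M i (Suc k))"
    then obtain i j l where "i \<in> {1..k}" "j \<in> {1..k}" "a \<in> M i j" "l \<in> {1..k}" "b \<in> M l (Suc k)"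
      by blast
    moreover from this have "star b \<in> M (Suc k) l"
      using star_M[of l "Suc k"] k by auto
    ultimately show "a \<cdot> star b \<in> {0}"
      using mult_M_zero[of i j "Suc k" l a "star b"] k by auto
  qed simp
  then show "a \<cdot> star v = 0" by simp
  from arg_cong[OF this, of star] show "v \<cdot> star a = 0" by (simp add: star_simps)
qed

lemma diagonal_in_span:
  assumes "x \<in> M (Suc k) (Suc k)" "e (Suc k) \<in> G"
  shows "x \<in> span G"
proof -
  have "x = \<rho> (Suc k) x *\<^sub>R e (Suc k)"
    using diagonal_eq[of "Suc k" x] assms k by simp
  then show ?thesis
    using assms(2) by (metis span_base span_scale)
qed

text \<open>Generators are sorted by position: inside \<open>upper_block k\<close>, in the last
  column above the diagonal, or in the corner, where only multiples of the unit occur.\<close>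

lemma upper_block_Suc_cases:
  assumes "t \<in> upper_block (Suc k)"
  obtains u w \<tau> where "u \<in> upper_block k" "w \<in> column k" "t = u + w + \<tau> *\<^sub>R e (Suc k)"
proof -
  let ?U = "\<Union>i\<in>{1..k}. \<Union>j\<in>{i..k}. M i j" and ?C = "\<Union>i\<in>{1..k}. M i (Suc k)"
  have "x \<in> span (?U \<union> ?C \<union> {e (Suc k)})"
    if ij: "i \<in> {1..Suc k}" "j \<in> {i..Suc k}" "x \<in> M i j" for i j x
  proof -
    consider "j \<le> k" | "i \<le> k" "j = Suc k" | "i = Suc k" "j = Suc k" using ij by force
    then show ?thesis
    proof cases
      case 1
      then have "x \<in> ?U" using ij by force
      then show ?thesis by (intro span_base) blast
    next
      case 2
      then have "x \<in> ?C" using ij by force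
      then show ?thesis by (intro span_base) blast
    next
      case 3
      then show ?thesis using ij by (intro diagonal_in_span) auto
    qed
  qed
  then have "upper_block (Suc k) \<subseteq> span (?U \<union> ?C \<union> {e (Suc k)})"
    unfolding upper_block_def by (intro span_minimal subspace_span) blast
  then show ?thesis
    using assms that unfolding span_Un span_singleton upper_block_def[of k] column_def by blast
qed

lemma block_Suc_cases:
  assumes "a \<in> block (Suc k)"
  obtains b v w \<alpha> where "b \<in> block k" "v \<in> column k" "w \<in> column k"
    "a = b + v + star w + \<alpha> *\<^sub>R e (Suc k)"
proof -
  let ?B = "\<Union>i\<in>{1..k}. \<Union>j\<in>{1..k}. M i j" and ?C = "\<Union>i\<in>{1..k}. M i (Suc k)"
  have "x \<in> span (?B \<union> ?C \<union> star ` ?C \<union> {e (Suc k)})"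
    if ij: "i \<in> {1..Suc k}" "j \<in> {1..Suc k}" "x \<in> M i j" for i j x
  proof -
    consider "i \<le> k" "j \<le> k" | "i \<le> k" "j = Suc k" | "i = Suc k" "j \<le> k" | "i = Suc k" "j = Suc k"
      using ij by force
    then show ?thesis
    proof cases
      case 1
      then have "x \<in> ?B" using ij by force
      then show ?thesis by (intro span_base) blast
    next
      case 2
      then have "x \<in> ?C" using ij by force
      then show ?thesis by (intro span_base) blast
    next
      case 3
      then have "x \<in> star ` M j (Suc k)" using ij star_M[of j "Suc k"] k by auto
      then have "x \<in> star ` ?C" using ij 3 by force
      then show ?thesis by (intro span_base) blast
    next
      case 4
      then show ?thesis using ij by (intro diagonal_in_span) auto
    qed
  qed
  then have "block (Suc k) \<subseteq> span (?B \<union> ?C \<union> star ` ?C \<union> {e (Suc k)})"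
    unfolding block_def by (intro span_minimal subspace_span) blast
  then show ?thesis
    using assms that
    unfolding span_Un span_singleton linear_span_image[OF linear_star] block_def[of k] column_def
    by blast
qed

text \<open>Right multiplication by \<open>e (Suc k)\<close> extracts the last column. Comparing the
  last columns of \<open>a\<close> and \<open>star a\<close> gives \<open>w = v\<close>, and what
  remains gives \<open>star b = b\<close>.\<close>

lemma hermitian_block_Suc_cases:
  assumes "a \<in> block (Suc k)" "star a = a"
  obtains b v \<alpha> where "b \<in> block k" "star b = b" "v \<in> column k"
    "a = b + v + star v + \<alpha> *\<^sub>R e (Suc k)"
proof -
  obtain b v w \<alpha> where a: "b \<in> block k" "v \<in> column k" "w \<in> column k"
      "a = b + v + star w + \<alpha> *\<^sub>R e (Suc k)"
    using block_Suc_cases[OF assms(1)] .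
  have "star b \<in> block k"
    using star_block a(1) k by simp
  moreover have "star a = star b + star v + w + \<alpha> *\<^sub>R e (Suc k)"
    using k by (simp add: a(4) star_simps star_unit)
  ultimately have "star a \<cdot> e (Suc k) = w + \<alpha> *\<^sub>R e (Suc k)"
    using a by (simp add: mult_simps block_unit column_unit unit_unit)
  moreover have "a \<cdot> e (Suc k) = v + \<alpha> *\<^sub>R e (Suc k)"
    using a by (simp add: mult_simps block_unit column_unit unit_unit)
  ultimately have "w = v"
    using assms(2) by simp
  moreover from this have "star b = b"
    using assms(2) k by (simp add: a(4) star_simps star_unit)
  ultimately show ?thesis using that a by blast
qed

lemma mult_unit_eq:
  assumes "b \<in> block k" "v \<in> column k" "a = b + v + star v + \<alpha> *\<^sub>R e (Suc k)"
  shows "a \<cdot> e (Suc k) = v + \<alpha> *\<^sub>R e (Suc k)"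
  using assms by (simp add: mult_simps block_unit column_unit unit_unit)

lemma pivot_eq:
  assumes "b \<in> block k" "v \<in> column k" "a = b + v + star v + \<alpha> *\<^sub>R e (Suc k)"
  shows "pivot (Suc k) a = \<alpha>"
  using k assms(2) unfolding pivot_def mult_unit_eq[OF assms]
  by (simp add: mult_simps column_unit unit_unit rho_unit linear_scale[OF linear_rho])

lemma column_square:
  assumes "v \<in> column k"
  shows "(v + \<alpha> *\<^sub>R e (Suc k)) \<cdot> star (v + \<alpha> *\<^sub>R e (Suc k)) =
    v \<cdot> star v + \<alpha> *\<^sub>R v + \<alpha> *\<^sub>R star v + (\<alpha> * \<alpha>) *\<^sub>R e (Suc k)"
  using k assms by (simp add: mult_simps star_simps star_unit column_unit unit_unit algebra_simps)

text \<open>The terms of \<open>column_square\<close> in \<open>v\<close>, \<open>star v\<close> and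
  \<open>e (Suc k)\<close> cancel against those of \<open>\<alpha> *\<^sub>R a\<close>. The last row
  and column are thus eliminated without division by \<open>\<alpha>\<close>.\<close>

lemma schur_eq:
  assumes "b \<in> block k" "v \<in> column k" "a = b + v + star v + \<alpha> *\<^sub>R e (Suc k)"
  shows "schur (Suc k) a = \<alpha> *\<^sub>R b - v \<cdot> star v"
  unfolding schur_def mult_unit_eq[OF assms] pivot_eq[OF assms] column_square[OF assms(2)]
  by (simp add: assms(3) algebra_simps)

text \<open>The cross terms of \<open>u\<close> with the last column vanish because their inner
  indices differ. The result is again in block form, with last column
  \<open>\<tau> *\<^sub>R w\<close> above the corner entry.\<close>

lemma upper_square:
  assumes "u \<in> block k" "w \<in> column k"
  shows "(u + w + \<tau> *\<^sub>R e (Suc k)) \<cdot> star (u + w + \<tau> *\<^sub>R e (Suc k)) =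
    (u \<cdot> star u + w \<cdot> star w) + \<tau> *\<^sub>R w + \<tau> *\<^sub>R star w + (\<tau> * \<tau>) *\<^sub>R e (Suc k)"
proof -
  have "star u \<in> block k" using star_block assms k by simp
  then show ?thesis
    using k assms
    by (simp add: mult_simps star_simps star_unit column_unit block_unit block_star_column
        unit_unit algebra_simps)
qed

lemma block_star_block:
  assumes "u \<in> block k"
  shows "u \<cdot> star u \<in> block k"
proof (rule span_mult_subset[OF bilinear_mult subspace_block])
  show "u \<in> span (\<Union>i\<in>{1..k}. \<Union>j\<in>{1..k}. M i j)"
    "star u \<in> span (\<Union>i\<in>{1..k}. \<Union>j\<in>{1..k}. M i j)"
    using assms star_block[OF _ assms] k by (simp_all add: block_def)
  fix a b assume "a \<in> (\<Union>i\<in>{1..k}. \<Union>j\<in>{1..k}. M i j)" "b \<in> (\<Union>i\<in>{1..k}. \<Union>j\<in>{1..k}. M i j)"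
  then obtain i j l m where *: "i \<in> {1..k}" "j \<in> {1..k}" "a \<in> M i j"
      "l \<in> {1..k}" "m \<in> {1..k}" "b \<in> M l m"
    by blast
  show "a \<cdot> b \<in> block k"
  proof (cases "j = l")
    case True
    then have "a \<cdot> b \<in> M i m" using * k mult_M[of i j m a b] by auto
    then show ?thesis using * block_base by blast
  next
    case False
    then have "a \<cdot> b = 0" using * k mult_M_zero[of i j l m a b] by auto
    then show ?thesis by (simp add: subspace_0 subspace_block)
  qed
qed

text \<open>In the Schur complement the two contributions of \<open>w \<cdot> star w\<close> cancel,
  and a multiple of the square of the smaller factor \<open>u\<close> is left. The scalar
  \<open>s\<close> is carried along so that this can be iterated.\<close>

lemma upper_square_pivot_schur:
  assumes "u \<in> block k" "w \<in> column k" "t = u + w + \<tau> *\<^sub>R e (Suc k)"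
  shows "pivot (Suc k) (s *\<^sub>R (t \<cdot> star t)) = s * \<tau>\<^sup>2"
    "schur (Suc k) (s *\<^sub>R (t \<cdot> star t)) = (s\<^sup>2 * \<tau>\<^sup>2) *\<^sub>R (u \<cdot> star u)"
proof -
  let ?b = "s *\<^sub>R (u \<cdot> star u + w \<cdot> star w)" and ?v = "(s * \<tau>) *\<^sub>R w"
  have *: "?b \<in> block k" "?v \<in> column k"
    using assms
    by (simp_all add: subspace_scale subspace_add subspace_block subspace_column
        column_star_column block_star_block)
  have **: "s *\<^sub>R (t \<cdot> star t) = ?b + ?v + star ?v + (s * \<tau>\<^sup>2) *\<^sub>R e (Suc k)"
    unfolding assms(3) upper_square[OF assms(1,2)]
    by (simp add: star_simps scaleR_add_right power2_eq_square mult.assoc)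
  show "pivot (Suc k) (s *\<^sub>R (t \<cdot> star t)) = s * \<tau>\<^sup>2"
    using pivot_eq[OF * **] .
  show "schur (Suc k) (s *\<^sub>R (t \<cdot> star t)) = (s\<^sup>2 * \<tau>\<^sup>2) *\<^sub>R (u \<cdot> star u)"
    using schur_eq[OF * **] by (simp add: mult_simps star_simps algebra_simps power2_eq_square)
qed

lemma unit_in_upper_block: "e (Suc k) \<in> upper_block (Suc k)"
  unfolding upper_block_def using unit_M[of "Suc k"] k
  by (intro span_base UN_I[of "Suc k"]) auto

lemma column_subset_upper_block: "column k \<subseteq> upper_block (Suc k)"
  unfolding upper_block_def column_def by (intro span_mono) force

end

section \<open>Reversing the elimination\<close>

text \<open>The Schur complement factors by induction as \<open>u \<cdot> star u\<close>. Bordering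
  \<open>u\<close> with the last column of \<open>a\<close> gives a factor of
  \<open>\<alpha> *\<^sub>R a\<close>, and \<open>\<alpha>\<close> is positive.\<close>

lemma cholesky:
  assumes "k \<le> r" "a \<in> block k" "star a = a" "pivots_pos k a"
  shows "\<exists>t\<in>upper_block k. a = t \<cdot> star t"
  using assms
proof (induction k arbitrary: a)
  case 0
  then show ?case by (simp add: block_def upper_block_def mult_simps)
next
  case (Suc k)
  obtain b v \<alpha> where *: "b \<in> block k" "star b = b" "v \<in> column k"
      "a = b + v + star v + \<alpha> *\<^sub>R e (Suc k)"
    using hermitian_block_Suc_cases[OF Suc.prems(1,2,3)] .
  note eqs = pivot_eq[OF Suc.prems(1) *(1,3,4)] schur_eq[OF Suc.prems(1) *(1,3,4)]
  have "\<alpha> > 0" using Suc.prems(4) eqs by simp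
  have "\<alpha> *\<^sub>R b - v \<cdot> star v \<in> block k"
    using * column_star_column[OF Suc.prems(1) *(3,3)]
    by (simp add: subspace_diff subspace_scale subspace_block)
  moreover have "star (\<alpha> *\<^sub>R b - v \<cdot> star v) = \<alpha> *\<^sub>R b - v \<cdot> star v"
    using * by (simp add: star_simps)
  ultimately obtain u where u: "u \<in> upper_block k" "\<alpha> *\<^sub>R b - v \<cdot> star v = u \<cdot> star u"
    using Suc.IH[of "\<alpha> *\<^sub>R b - v \<cdot> star v"] Suc.prems eqs by auto
  \<comment> \<open>The last column of \<open>t\<close> is \<open>a \<cdot> e (Suc k)\<close>. In
    the square of \<open>t\<close>, the term \<open>v \<cdot> star v\<close> restores what the Schur
    complement has subtracted.\<close>
  define t where "t = u + v + \<alpha> *\<^sub>R e (Suc k)"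
  have "t \<cdot> star t = \<alpha> *\<^sub>R a"
    using upper_square[OF Suc.prems(1) _ *(3), of u \<alpha>] upper_block_subset_block u(1)
    by (auto simp: t_def *(4) u(2)[symmetric] algebra_simps)
  \<comment> \<open>The scalar enters the square twice, so dividing \<open>t\<close> by
    \<open>sqrt \<alpha>\<close> removes the factor \<open>\<alpha>\<close>.\<close>
  then have "a = ((1 / sqrt \<alpha>) *\<^sub>R t) \<cdot> star ((1 / sqrt \<alpha>) *\<^sub>R t)"
    using \<open>\<alpha> > 0\<close> by (simp add: mult_simps star_simps)
  moreover have "t \<in> upper_block (Suc k)"
    using u(1) *(3) upper_block_mono[of k "Suc k"] column_subset_upper_block[OF Suc.prems(1)]
      unit_in_upper_block[OF Suc.prems(1)] unfolding t_def
    by (intro subspace_add subspace_scale subspace_upper_block) auto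
  ultimately show ?case
    using subspace_scale[OF subspace_upper_block] by blast
qed

section \<open>Pivots of squares\<close>

lemma linear_pivot: "k \<in> {1..r} \<Longrightarrow> linear (pivot k)"
  unfolding linear_iff pivot_def
  by (simp add: mult_simps linear_add[OF linear_rho] linear_scale[OF linear_rho])

lemma schur_0: "k \<in> {1..r} \<Longrightarrow> schur k 0 = 0"
  by (simp add: schur_def mult_simps)

text \<open>Schur complements of 0 are 0, and the final pivot is linear. The case
  \<open>k = 0\<close> is excluded because \<open>last_pivot 0\<close> has the constant value
  1.\<close>

lemma last_pivot_0: "\<lbrakk>k \<noteq> 0; k \<le> r\<rbrakk> \<Longrightarrow> last_pivot k 0 = 0"
  by (induction k) (auto simp: linear_0[OF linear_pivot] schur_0)

text \<open>Each pivot is a positive multiple of the square of a diagonal entry of \<open>t\<close>,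
  and a single vanishing entry would annihilate all that follows.\<close>

lemma last_pivot_nonzero_imp_pivots_pos:
  assumes "k \<le> r" "t \<in> upper_block k" "s > 0" "last_pivot k (s *\<^sub>R (t \<cdot> star t)) \<noteq> 0"
  shows "pivots_pos k (s *\<^sub>R (t \<cdot> star t))"
  using assms
proof (induction k arbitrary: t s)
  case (Suc k)
  obtain u w \<tau> where *: "u \<in> upper_block k" "w \<in> column k" "t = u + w + \<tau> *\<^sub>R e (Suc k)"
    using upper_block_Suc_cases[OF Suc.prems(1,2)] .
  have "u \<in> block k" using * upper_block_subset_block by blast
  note eqs = upper_square_pivot_schur[OF Suc.prems(1) this *(2,3), of s]
  \<comment> \<open>For \<open>\<tau> = 0\<close> both the pivot and the Schur complement are 0.
    This covers the two branches of \<open>last_pivot\<close>: stopping at this pivot, and going on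
    with the complement.\<close>
  have "\<tau> \<noteq> 0"
  proof
    assume "\<tau> = 0"
    then have "last_pivot (Suc k) (s *\<^sub>R (t \<cdot> star t)) = 0"
      using Suc.prems(1) last_pivot_0[of k] by (simp only: last_pivot.simps eqs) simp
    with Suc.prems(4) show False ..
  qed
  then have s: "s * \<tau>\<^sup>2 > 0" "s\<^sup>2 * \<tau>\<^sup>2 > 0"
    using Suc.prems(3) by auto
  \<comment> \<open>For \<open>k = 0\<close> no pivot is left to check; otherwise the last pivot is
    that of the complement, and the induction hypothesis applies with the new scalar.\<close>
  have "pivots_pos k ((s\<^sup>2 * \<tau>\<^sup>2) *\<^sub>R (u \<cdot> star u))"
  proof (cases "k = 0")
    case False
    then have "last_pivot k ((s\<^sup>2 * \<tau>\<^sup>2) *\<^sub>R (u \<cdot> star u)) \<noteq> 0"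
      using Suc.prems(4) by (simp add: eqs)
    then show ?thesis
      using Suc.IH[OF _ *(1) s(2)] Suc.prems(1) by simp
  qed simp
  then show ?case
    using s(1) by (simp add: eqs)
qed simp

text \<open>The induction builds the sum of the units \<open>e i\<close>, whose pivots are powers of
  \<open>s\<close>. The claim covers all positive \<open>s\<close> because each elimination step
  changes the scalar. It shows that the last pivot is not the zero polynomial.\<close>

lemma exists_last_pivot_nonzero:
  assumes "k \<le> r"
  shows "\<exists>t\<in>upper_block k. \<forall>s>0. last_pivot k (s *\<^sub>R (t \<cdot> star t)) \<noteq> 0"
  using assms
proof (induction k)
  case 0
  show ?case using subspace_0[OF subspace_upper_block] by auto
next
  case (Suc k)
  then obtain u where u: "u \<in> upper_block k" "\<forall>s>0. last_pivot k (s *\<^sub>R (u \<cdot> star u)) \<noteq> 0"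
    by auto
  \<comment> \<open>The zero column and the factor 1 bring \<open>?t\<close> into the form required
    by \<open>upper_square_pivot_schur\<close>, with \<open>\<tau> = 1\<close>.\<close>
  let ?t = "u + 0 + 1 *\<^sub>R e (Suc k)"
  have "u \<in> block k" using u upper_block_subset_block by blast
  note eqs = upper_square_pivot_schur[OF Suc.prems(1) this subspace_0[OF subspace_column] refl, of _ 1]
  have "?t \<in> upper_block (Suc k)"
    using u(1) upper_block_mono[of k "Suc k"] unit_in_upper_block[OF Suc.prems(1)]
    by (auto intro: subspace_add subspace_upper_block)
  moreover have "last_pivot (Suc k) (s *\<^sub>R (?t \<cdot> star ?t)) \<noteq> 0" if "s > 0" for s
    using that u(2) by (simp only: last_pivot.simps eqs) simp
  ultimately show ?case by blast
qed

section \<open>Degree and continuity of the pivots\<close>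

text \<open>Both terms of \<open>schur\<close> are bilinear maps evaluated at a repeated argument,
  so the degree doubles.\<close>

lemma polynomial_map_schur:
  assumes "polynomial_map d f" "k \<in> {1..r}"
  shows "polynomial_map (2 * d) (\<lambda>x. schur k (f x))"
proof -
  have "bilinear (\<lambda>a b. pivot k a *\<^sub>R b)" "bilinear (\<lambda>a b. (a \<cdot> e k) \<cdot> star (b \<cdot> e k))"
    using linear_pivot[OF assms(2)]
    by (auto simp: bilinear_def linear_iff mult_simps star_simps algebra_simps)
  note this[THEN polynomial_map_bilinear[OF assms(1,1)]]
  then show ?thesis
    unfolding schur_def mult_2 by (rule polynomial_map_diff)
qed

text \<open>From order \<open>Suc k\<close> down to order 1 there are \<open>k\<close> Schur steps,
  each doubling the degree; the concluding pivot is linear. The induction varies \<open>f\<close>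
  and \<open>d\<close>, since one step replaces them by \<open>schur\<close> after \<open>f\<close>
  and \<open>2 * d\<close>.\<close>

lemma polynomial_last_pivot:
  assumes "polynomial_map d f" "Suc k \<le> r"
  shows "polynomial_on_deg_le UNIV (2 ^ k * d) (\<lambda>x. last_pivot (Suc k) (f x))"
  using assms
proof (induction k arbitrary: d f)
  case 0
  then show ?case
    using polynomial_map_real[OF polynomial_map_linear_compose[OF _ linear_pivot[of 1]]] by simp
next
  case (Suc k)
  then show ?case
    using Suc.IH[OF polynomial_map_schur[of d f "Suc (Suc k)"]]
    by (simp del: last_pivot.simps add: last_pivot.simps(2)[of "Suc k"] mult.assoc mult.left_commute)
qed

text \<open>Every pivot of \<open>f x\<close> is a polynomial in \<open>x\<close>, so finitely many
  strict inequalities between continuous functions are imposed. Openness is stated on the Euclidean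
  side because the algebra carries no topology.\<close>

lemma open_pivots_pos:
  assumes "polynomial_map d f" "k \<le> r"
  shows "open {x. pivots_pos k (f x)}"
  using assms
proof (induction k arbitrary: d f)
  case (Suc k)
  have k: "Suc k \<in> {1..r}" using Suc.prems(2) by simp
  have "continuous_on UNIV (\<lambda>x. pivot (Suc k) (f x))"
    using polynomial_map_linear_compose[OF Suc.prems(1) linear_pivot[OF k]]
    by (rule polynomial_on_deg_le_continuous[OF polynomial_map_real])
  then have "open {x. 0 < pivot (Suc k) (f x)}"
    by (intro open_Collect_less continuous_on_const)
  moreover have "open {x. pivots_pos k (schur (Suc k) (f x))}"
    using Suc.IH[OF polynomial_map_schur[OF Suc.prems(1) k]] Suc.prems(2) by simp
  ultimately show ?case
    by (simp add: open_Collect_conj)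
qed simp

lemma upper_block_r: "upper_block r = upper_triangular"
  by (simp add: upper_block_def upper_triangular_def)

section \<open>The last pivot as a boundary polynomial\<close>

lemma exists_boundary_polynomial:
  fixes \<phi> :: "'m \<Rightarrow> 'a::euclidean_space"
  assumes "linear \<phi>" "bij_betw \<phi> hermitian (span K)" "K = \<phi> ` associated_cone"
    "closed K" "K \<noteq> {0}"
  shows "\<exists>q. boundary_polynomial K q \<and> degree_on (span K) q \<le> 2 ^ (r - 1)"
proof -
  have herm: "subspace hermitian"
    by (auto simp: subspace_def hermitian_def star_simps)
  \<comment> \<open>A linear left inverse defined on the whole ambient space transports the pivots:
    \<open>\<psi>\<close> is a polynomial map of degree 1 that inverts \<open>\<phi>\<close> on the
    span of \<open>K\<close>.\<close>
  obtain \<psi> where \<psi>: "linear \<psi>" "\<And>a. a \<in> hermitian \<Longrightarrow> \<psi> (\<phi> a) = a"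
    using linear_exists_left_inverse_on[OF assms(1) herm bij_betw_imp_inj_on[OF assms(2)]] by blast
  have sq: "t \<cdot> star t \<in> hermitian" for t
    by (simp add: hermitian_def star_simps)
  \<comment> \<open>In rank 0 the algebra is trivial and \<open>K\<close> would be
    \<open>{0}\<close>. Excluding it makes \<open>r\<close> the successor of \<open>r - 1\<close>,
    the number of Schur steps.\<close>
  have "r \<noteq> 0"
  proof
    assume "r = 0"
    then have *: "a = 0" for a :: 'm using block_r by (auto simp: block_def)
    have "0 \<in> associated_cone"
      using subspace_0[OF subspace_upper_block, of r] *[of "0 \<cdot> star 0"]
      unfolding associated_cone_def upper_block_r by force
    then have "associated_cone = {0}" using * by blast
    then have "K = {0}"
      using assms(3) linear_0[OF assms(1)] by simp
    with assms(5) show False ..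
  qed
  let ?q = "\<lambda>x. last_pivot r (\<psi> x)"
  have "polynomial_on_deg_le UNIV (2 ^ (r - 1)) ?q"
    using polynomial_last_pivot[OF polynomial_map_linear[OF \<psi>(1)], of "r - 1"] \<open>r \<noteq> 0\<close> by simp
  then have q: "polynomial_on_deg_le (span K) (2 ^ (r - 1)) ?q"
    by (rule polynomial_on_deg_le_subset) simp
  have "\<exists>x\<in>span K. ?q x \<noteq> 0"
  proof -
    obtain t where "\<forall>s>0. last_pivot r (s *\<^sub>R (t \<cdot> star t)) \<noteq> 0"
      using exists_last_pivot_nonzero by blast
    from this[rule_format, of 1] have "?q (\<phi> (t \<cdot> star t)) \<noteq> 0"
      by (simp add: \<psi>(2) sq)
    then show ?thesis
      using sq bij_betwE[OF assms(2)] by blast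
  qed
  moreover have "?q x = 0" if x: "x \<in> rel_frontier K" for x
  proof (rule ccontr)
    assume nz: "?q x \<noteq> 0"
    have "x \<in> K" "x \<notin> rel_interior K"
      using x assms(4) by (simp_all add: rel_frontier_def)
    then obtain t where t: "t \<in> upper_block r" "x = \<phi> (t \<cdot> star t)"
      using assms(3) unfolding associated_cone_def upper_block_r by blast
    have "pivots_pos r (\<psi> x)"
      using last_pivot_nonzero_imp_pivots_pos[OF _ t(1), of 1] nz by (simp add: t(2) \<psi>(2) sq)
    \<comment> \<open>Positive pivots suffice for membership on the whole span:
      \<open>\<psi> y\<close> is hermitian, and its Cholesky factor exhibits \<open>y\<close> as a
      point of the cone.\<close>
    moreover have "y \<in> K" if y: "y \<in> span K" "pivots_pos r (\<psi> y)" for y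
    proof -
      obtain a where a: "a \<in> hermitian" "y = \<phi> a"
        using y(1) assms(2) by (metis bij_betw_imp_surj_on imageE)
      then have "\<exists>t\<in>upper_block r. a = t \<cdot> star t"
        using y(2) by (intro cholesky) (auto simp: block_r \<psi>(2) hermitian_def)
      then show ?thesis
        using a(2) assms(3) unfolding associated_cone_def upper_block_r by blast
    qed
    moreover have "open {y. pivots_pos r (\<psi> y)}"
      by (rule open_pivots_pos[OF polynomial_map_linear[OF \<psi>(1)]]) simp
    \<comment> \<open>The points with positive pivots form an open neighbourhood of
      \<open>x\<close>, and its intersection with the affine hull, which lies in the span, is
      contained in \<open>K\<close>.\<close>
    ultimately have "x \<in> rel_interior K"
      using \<open>x \<in> K\<close> affine_hull_subset_span[of K] unfolding rel_interior
      by (auto intro!: exI[of _ "{y. pivots_pos r (\<psi> y)}"])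
    with \<open>x \<notin> rel_interior K\<close> show False ..
  qed
  ultimately have "boundary_polynomial K ?q"
    using q unfolding boundary_polynomial_def polynomial_on_def by blast
  moreover have "degree_on (span K) ?q \<le> 2 ^ (r - 1)"
    unfolding degree_on_def using q by (rule Least_le)
  ultimately show ?thesis by blast
qed

end

theorem proposition4p5:
  fixes K :: "'a::euclidean_space set" and n :: nat and p :: "'a \<Rightarrow> real"
  assumes "homogeneous_cone K"
    and "pointed_cone K"
    and "K \<noteq> {0}"
    and "has_rank TYPE('m::real_vector) K n"
    and "minimal_polynomial K p"
  shows "degree_on (span K) p \<le> 2 ^ (n - 1)"
proof -
  obtain M and mult :: "'m \<Rightarrow> 'm \<Rightarrow> 'm" and star \<rho> e \<phi> where
    T: "T_algebra n M mult star \<rho> e" and \<phi>: "linear \<phi>"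
      "bij_betw \<phi> (T_algebra.hermitian star) (span K)"
      "K = \<phi> ` T_algebra.associated_cone n M mult star"
    using assms(4) unfolding has_rank_def by blast
  have "closed K" using assms(1) by (simp add: homogeneous_cone_def)
  \<comment> \<open>The polynomial \<open>q\<close> is the last pivot carried over to the span of
    \<open>K\<close>; the minimality of \<open>p\<close> is applied to it.\<close>
  then obtain q where "boundary_polynomial K q" "degree_on (span K) q \<le> 2 ^ (n - 1)"
    using T_algebra.exists_boundary_polynomial[OF T \<phi> _ assms(3)] by blast
  then show ?thesis
    using assms(5) unfolding minimal_polynomial_def by (meson order_trans)
qed

end
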